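(* Let $f$ be a function of the form $$f(\mathbf{x})=h(\mathbf{x})+\mathbf{x}^{\mathsf T}\mathsf{A}\mathbf{x}+2\mathbf{a}^{\mathsf T}\mathbf{x}+\max_{\mathbf{u}\in\mathbb{R}^q}\{2\mathbf{u}^{\mathsf T}\mathsf{B}\mathbf{x}+\mathbf{u}^{\mathsf T}\mathsf{C}\mathbf{u}+2\mathbf{c}^{\mathsf T}\mathbf{u}:\mathbf{u}\in\mathcal{U}\},\qquad \mathbf{x}\in\mathbb{R}^n,$$ where $h$ is a closed proper concave function on $\mathbb{R}^n$, $\mathcal{U}\subseteq\mathbb{R}^q$ is nonempty, compact and convex, $\mathsf{A}\in\mathcal{S}^n$, $\mathsf{B}\in\mathbb{R}^{q\times n}$, $\mathsf{C}\in\mathcal{S}^q$, $\mathbf{a}\in\mathbb{R}^n$, $\mathbf{c}\in\mathbb{R}^q$. Let $\mathcal{X}\subseteq\mathbb{R}^n$ be such that $f$ is finite on $\mathcal{X}$. Let $\mathcal{C}\subseteq\mathcal{S}^{n+q+1}$ be a closed convex set such that $\mathcal{S}^{n+q+1}_+\supseteq\mathcal{C}\supseteq\mathcal{G}(\mathcal{U}\times\mathcal{X})$. Finally let $\mathcal{A}:\mathcal{S}^n\times\mathbb{R}^n\to\mathbb{R}^m$ be a linear function and $\mathbf{b}\in\mathbb{R}^m$ such that $$\left\{\begin{bmatrix}1&\mathbf{x}^{\mathsf T}\\ \mathbf{x}&\mathsf{X}\end{bmatrix}\in\mathcal{S}^{n+1}_+:\mathcal{A}(\mathsf{X},\mathbf{x})=\mathbf{b}\right\}\supseteq\mathcal{G}(\mathcal{X}),\qquad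 \{\mathsf{X}\in\mathcal{S}^n_+:\mathcal{A}(\mathsf{X},\mathbf{0})=\mathbf{0}\}=\{\mathsf{O}\}.$$ Define, for $\mathbf{x}\in\mathbb{R}^n$, $$g(\mathbf{x})=h(\mathbf{x})+\sup_{\Psi,\mathbf{u},\mathsf{U},\mathsf{X}}\left\{\begin{array}{l}\mathsf{A}\bullet\mathsf{X}+2\mathbf{a}^{\mathsf T}\mathbf{x}+2\mathsf{B}^{\mathsf T}\bullet\Psi+\mathsf{C}\bullet\mathsf{U}+2\mathbf{c}^{\mathsf T}\mathbf{u}\ :\\[2pt] \begin{bmatrix}1&\mathbf{u}^{\mathsf T}&\mathbf{x}^{\mathsf T}\\ \mathbf{u}&\mathsf{U}&\Psi^{\mathsf T}\\ \mathbf{x}&\Psi&\mathsf{X}\end{bmatrix}\in\mathcal{C},\ \begin{bmatrix}1&\mathbf{u}^{\mathsf T}\\ \mathbf{u}&\mathsf{U}\end{bmatrix}\in\mathcal{G}(\mathcal{U}),\ \mathcal{A}(\mathsf{X},\mathbf{x})=\mathbf{b}\end{array}\right\},$$ where $\Psi\in\mathbb{R}^{n\times q}$, $\mathbf{u}\in\mathbb{R}^q$, $\mathsf{U}\in\mathcal{S}^q$, $\mathsf{X}\in\mathcal{S}^n$. Then $g$ is a concave tent of $f$ over $\mathcal{X}$, and it is closed and proper if $\mathcal{X}\ne\emptyset$. If $\mathsf{C}=\mathsf{O}$, the statement remains true even if $\mathcal{G}(\mathcal{U})$ in the definition of $g$ is replaced by any compact convex set $\mathcal{G}_{\mathcal{U}}\subseteq\mathcal{S}^{q+1}$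 with $\mathcal{G}_{\mathcal{U}}\supseteq\mathcal{G}(\mathcal{U})$ such that $\begin{bmatrix}1&\mathbf{u}^{\mathsf T}\\ \mathbf{u}&\mathsf{U}\end{bmatrix}\in\mathcal{G}_{\mathcal{U}}$ implies $\mathbf{u}\in\mathcal{U}$.
   Context: $\mathcal{S}^d$ is the space of symmetric $d\times d$ matrices, $\mathcal{S}^d_+$ the cone of positive semidefinite ones, $\mathsf{O}$ the zero matrix, $\mathsf{M}\bullet\mathsf{N}=\operatorname{Tr}(\mathsf{M}^{\mathsf T}\mathsf{N})$. For $\mathcal{F}\subseteq\mathbb{R}^d$, $\mathcal{G}(\mathcal{F})\subseteq\mathcal{S}^{d+1}$ is the closure of the convex hull of $\left\{\begin{bmatrix}1\\ \mathbf{y}\end{bmatrix}\begin{bmatrix}1\\ \mathbf{y}\end{bmatrix}^{\mathsf T}:\mathbf{y}\in\mathcal{F}\right\}$; elements of $\mathcal{U}\times\mathcal{X}$ are vectors $(\mathbf{u}^{\mathsf T},\mathbf{x}^{\mathsf T})^{\mathsf T}\in\mathbb{R}^{q+n}$. Convention: $\sup\emptyset=-\infty$. A concave function is proper if it is smaller than $\infty$ everywhere and larger than $-\infty$ in at least one point; a proper concave function is closed if it is upper semicontinuous. For a function $f$ finite on $\mathcal{X}\subseteq\mathbb{R}^n$, a concave tent of $f$ over $\mathcal{X}$ is a function $g:\mathbb{R}^n\to\mathbb{R}\cup\{\pm\infty\}$ that is concave over $\operatorname{conv}(\mathcal{X})$ (i.e. $\{(\mathbf{x},t):\mathbf{x}\in\operatorname{conv}(\mathcal{X}),\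 t\in\mathbb{R},\ t\le g(\mathbf{x})\}$ is convex) and satisfies $g(\mathbf{x})=f(\mathbf{x})$ for all $\mathbf{x}\in\mathcal{X}$. *)

theory Defs
  imports "HOL-Analysis.Analysis"
begin

definition sym_mats :: "(real^'d^'d) set" where
  "sym_mats = {M. transpose M = M}"

definition psd_mats :: "(real^'d^'d) set" where
  "psd_mats = {M \<in> sym_mats. \<forall>v. 0 \<le> v \<bullet> (M *v v)}"

definition frob :: "real^'q^'n \<Rightarrow> real^'q^'n \<Rightarrow> real" where
  "frob M N = trace (transpose M ** N)"

text \<open>Vectors and matrices with one additional leading coordinate are indexed by the option
  type, where None is the extra coordinate. Concatenated vectors and $2 \times 2$ block matrices
  are indexed by a sum type.\<close>

definition lift_vec :: "real^'d \<Rightarrow> real^('d option)" where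
  "lift_vec y = (\<chi> i. case i of None \<Rightarrow> 1 | Some k \<Rightarrow> y $ k)"

definition outer_square :: "real^'d \<Rightarrow> real^'d^'d" where
  "outer_square v = (\<chi> i j. v $ i * v $ j)"

definition \<G> :: "(real^'d) set \<Rightarrow> (real^('d option)^('d option)) set" where
  "\<G> F = closure (convex hull ((\<lambda>y. outer_square (lift_vec y)) ` F))"

text \<open>The matrix with rows $(1, x^T)$ and $(x, X)$.\<close>

definition bordered :: "real^'d \<Rightarrow> real^'d^'d \<Rightarrow> real^('d option)^('d option)" where
  "bordered x X = (\<chi> i j.
     case i of
       None \<Rightarrow> (case j of None \<Rightarrow> 1 | Some l \<Rightarrow> x $ l)
     | Some k \<Rightarrow> (case j of None \<Rightarrow> x $ k | Some l \<Rightarrow> X $ k $ l))"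

definition join :: "real^'q \<Rightarrow> real^'n \<Rightarrow> real^('q + 'n)" where
  "join u x = (\<chi> i. case i of Inl k \<Rightarrow> u $ k | Inr k \<Rightarrow> x $ k)"

definition join_sets :: "(real^'q) set \<Rightarrow> (real^'n) set \<Rightarrow> (real^('q + 'n)) set" where
  "join_sets \<U> \<X> = {join u x | u x. u \<in> \<U> \<and> x \<in> \<X>}"

text \<open>The matrix with rows $(U, \Psi^T)$ and $(\Psi, X)$; here $\Psi$ has $n$ rows and $q$ columns.\<close>

definition block_mat ::
  "real^'q^'q \<Rightarrow> real^'q^'n \<Rightarrow> real^'n^'n \<Rightarrow> real^('q + 'n)^('q + 'n)" where
  "block_mat U \<Psi> X = (\<chi> i j.
     case i of
       Inl k \<Rightarrow> (case j of Inl l \<Rightarrow> U $ k $ l | Inr l \<Rightarrow> transpose \<Psi> $ k $ l)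
     | Inr k \<Rightarrow> (case j of Inl l \<Rightarrow> \<Psi> $ k $ l | Inr l \<Rightarrow> X $ k $ l))"

text \<open>Linearity of a map whose domain is a subspace; nothing is required outside of it.\<close>

definition linear_on_subspace ::
  "'a::real_vector set \<Rightarrow> ('a \<Rightarrow> 'b::real_vector) \<Rightarrow> bool" where
  "linear_on_subspace S L \<longleftrightarrow>
     (\<forall>x\<in>S. \<forall>y\<in>S. L (x + y) = L x + L y) \<and> (\<forall>x\<in>S. \<forall>r. L (r *\<^sub>R x) = r *\<^sub>R L x)"

definition ereal_concave_on :: "'a::real_vector set \<Rightarrow> ('a \<Rightarrow> ereal) \<Rightarrow> bool" where
  "ereal_concave_on S g \<longleftrightarrow> convex {(x, t :: real). x \<in> S \<and> ereal t \<le> g x}"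

definition usc :: "('a::topological_space \<Rightarrow> ereal) \<Rightarrow> bool" where
  "usc g \<longleftrightarrow> (\<forall>x. Limsup (at x) g \<le> g x)"

definition closed_proper_concave :: "('a::real_normed_vector \<Rightarrow> ereal) \<Rightarrow> bool" where
  "closed_proper_concave g \<longleftrightarrow>
     ereal_concave_on UNIV g \<and> (\<forall>x. g x < \<infinity>) \<and> (\<exists>x. - \<infinity> < g x) \<and> usc g"

definition concave_tent ::
  "'a::real_vector set \<Rightarrow> ('a \<Rightarrow> ereal) \<Rightarrow> ('a \<Rightarrow> ereal) \<Rightarrow> bool" where
  "concave_tent \<X> f g \<longleftrightarrow> ereal_concave_on (convex hull \<X>) g \<and> (\<forall>x\<in>\<X>. g x = f x)"

text \<open>The supremum is taken in the extended reals, where the empty set has supremum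
  $-\infty$. The set \<open>GU\<close> constrains the bordered matrix of $u$ and $U$.\<close>

definition relaxation ::
  "(real^'n \<Rightarrow> ereal) \<Rightarrow> real^'n^'n \<Rightarrow> real^'n \<Rightarrow> real^'n^'q \<Rightarrow> real^'q^'q \<Rightarrow> real^'q \<Rightarrow>
   (real^(('q + 'n) option)^(('q + 'n) option)) set \<Rightarrow>
   ((real^'n^'n) \<times> (real^'n) \<Rightarrow> real^'m) \<Rightarrow> real^'m \<Rightarrow>
   (real^('q option)^('q option)) set \<Rightarrow> real^'n \<Rightarrow> ereal" where
  "relaxation h A a B C c \<C> \<A> b GU x =
     h x + Sup {ereal (frob A X + 2 * (a \<bullet> x) + 2 * frob (transpose B) \<Psi>
                       + frob C U + 2 * (c \<bullet> u)) | \<Psi> u U X.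
       U \<in> sym_mats \<and> X \<in> sym_mats \<and>
       bordered (join u x) (block_mat U \<Psi> X) \<in> \<C> \<and>
       bordered u U \<in> GU \<and>
       \<A> (X, x) = b}"

end

theory Submission
  imports Defs
begin

text \<open>
The relaxation is \<open>h\<close> plus the optimal value, as a function of the parameter \<open>x\<close>, of a linear
program over a closed convex set. If the optimization variables stay bounded while \<open>x\<close> does, the
supremum is attained, the hypograph of the value function is a projection of a convex set, and its
superlevel sets are closed; so the value function is concave, upper semicontinuous and nowhere
\<open>\<infinity>\<close>. All three properties survive adding \<open>h\<close>.

The boundedness (\<open>bounded_feasible\<close>) uses positive semidefiniteness throughout. The blocks
\<open>u\<close> and \<open>W\<close> range over a compact set. A linear map that vanishes at no nonzero positive
semidefinite matrix satisfies \<open>\<delta> * norm X \<le> norm (\<A> (X, 0))\<close> on the cone for some \<open>\<delta> > 0\<close>, hence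
the equation \<open>\<A> (X, x) = b\<close> bounds \<open>X\<close> in terms of \<open>x\<close>. The off-diagonal block is dominated by the
diagonal ones.

The relaxation agrees with \<open>f\<close> on \<open>\<X>\<close> because the lifting is exact there. For \<open>x \<in> \<X>\<close> the
equation holds at \<open>X = outer_square x\<close>, so for every feasible \<open>X\<close> the Schur complement
\<open>X - outer_square x\<close> is a positive semidefinite matrix in the kernel of \<open>\<A>\<close>, which is \<open>0\<close>. A
positive semidefinite matrix with this degenerate Schur complement must have off-diagonal block
\<open>outer x u\<close> (\<open>feasible_rank_one\<close>). What remains of the objective is a linear function of
\<open>bordered u W\<close>. Over \<open>\<G> \<U>\<close> it is bounded by its supremum over the rank-one generators, which is the
inner maximum in \<open>f\<close>; if \<open>C = 0\<close> it depends on \<open>u\<close> only, and \<open>u \<in> \<U>\<close> is enough. Conversely, the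
rank-one lifting of \<open>x\<close> together with a maximizer \<open>u\<close> is feasible and attains the value.
\<close>

section \<open>Concave and upper semicontinuous extended-real functions\<close>

lemma usc_less_open:
  assumes "usc g"
  shows "open {x. g x < ereal r}"
proof (subst open_subopen, intro ballI)
  fix x assume "x \<in> {x. g x < ereal r}"
  then have gx: "g x < ereal r" by simp
  moreover have "Limsup (at x) g \<le> g x" using assms by (simp add: usc_def)
  ultimately have "eventually (\<lambda>y. g y < ereal r) (at x)"
    by (intro Limsup_lessD) order
  with gx have "eventually (\<lambda>y. g y < ereal r) (nhds x)"
    by (simp add: eventually_nhds_conv_at)
  then show "\<exists>T. open T \<and> x \<in> T \<and> T \<subseteq> {x. g x < ereal r}"
    by (auto simp: eventually_nhds)
qed

lemma usc_if_less_open: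
  assumes "\<And>r. open {x. g x < ereal r}"
  shows "usc g"
  unfolding usc_def
proof (intro allI leI notI)
  fix x assume "g x < Limsup (at x) g"
  then obtain r where r: "g x < ereal r" "ereal r < Limsup (at x) g"
    using ereal_dense2 by blast
  have "eventually (\<lambda>y. y \<in> {x. g x < ereal r}) (nhds x)"
    using assms r(1) by (intro eventually_nhds_in_open) auto
  then have "eventually (\<lambda>y. g y \<le> ereal r) (at x)"
    by (auto simp: eventually_nhds_conv_at elim!: eventually_mono)
  then have "Limsup (at x) g \<le> ereal r" by (rule Limsup_bounded)
  with r(2) show False by simp
qed

text \<open>A sum is below \<open>r\<close> exactly if some real number \<open>p\<close> separates the two summands in the
  sense below; this writes the strict sublevel sets of the sum as unions of open sets.\<close>

lemma ereal_sum_less_split: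
  assumes "x < \<infinity>" "y < \<infinity>"
  shows "x + y < ereal r \<longleftrightarrow> (\<exists>p. x < ereal p \<and> y < ereal (r - p))"
proof
  assume *: "x + y < ereal r"
  show "\<exists>p. x < ereal p \<and> y < ereal (r - p)"
  proof (cases x)
    case (real a)
    \<comment> \<open>For finite \<open>x = a\<close> and \<open>y = b\<close> any \<open>p\<close> strictly between \<open>a\<close> and \<open>r - b\<close> works.\<close>
    show ?thesis
    proof (cases y)
      case (real b)
      with \<open>x = ereal a\<close> * have "a < (a + r - b) / 2" "b < r - (a + r - b) / 2"
        by (auto simp: field_simps)
      with real \<open>x = ereal a\<close> show ?thesis by (intro exI[of _ "(a + r - b) / 2"]) simp
    next
      case MInf
      with real show ?thesis by (intro exI[of _ "a + 1"]) simp
    qed (use assms in auto)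
  next
    case MInf
    obtain q where "y < ereal q" using assms(2) less_PInf_Ex_of_nat by fastforce
    with MInf show ?thesis by (intro exI[of _ "r - q"]) simp
  qed (use assms in auto)
next
  assume "\<exists>p. x < ereal p \<and> y < ereal (r - p)"
  then obtain p where "x < ereal p" "y < ereal (r - p)" by blast
  then have "x + y < ereal p + ereal (r - p)" by (intro ereal_add_strict_mono2)
  then show "x + y < ereal r" by simp
qed

lemma usc_add:
  assumes "usc g" "usc k" "\<And>x. g x < \<infinity>" "\<And>x. k x < \<infinity>"
  shows "usc (\<lambda>x. g x + k x)"
proof (rule usc_if_less_open)
  fix r
  have "{x. g x + k x < ereal r} = (\<Union>p. {x. g x < ereal p} \<inter> {x. k x < ereal (r - p)})"
    using ereal_sum_less_split[OF assms(3,4)] by auto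
  then show "open {x. g x + k x < ereal r}"
    using assms(1,2) by (auto intro!: usc_less_open open_UN open_Int)
qed

lemma ereal_concave_on_add:
  assumes "ereal_concave_on S g" "ereal_concave_on S k" "\<And>x. g x < \<infinity>" "\<And>x. k x < \<infinity>"
  shows "ereal_concave_on S (\<lambda>x. g x + k x)"
  unfolding ereal_concave_on_def
proof (rule convexI)
  fix p p' and u v :: real
  assume "p \<in> {(x, t). x \<in> S \<and> ereal t \<le> g x + k x}"
    "p' \<in> {(x, t). x \<in> S \<and> ereal t \<le> g x + k x}"
    and uv: "0 \<le> u" "0 \<le> v" "u + v = 1"
  then obtain x s y t where p: "p = (x, s)" "p' = (y, t)"
    and x: "x \<in> S" "ereal s \<le> g x + k x" and y: "y \<in> S" "ereal t \<le> g y + k y"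
    by blast
  have fin: "\<exists>a b. g z = ereal a \<and> k z = ereal b \<and> r \<le> a + b" if "ereal r \<le> g z + k z" for z r
    using that assms(3,4)[of z] by (cases "g z"; cases "k z") auto
  obtain a b where ab: "g x = ereal a" "k x = ereal b" "s \<le> a + b" using fin[OF x(2)] by blast
  obtain a' b' where ab': "g y = ereal a'" "k y = ereal b'" "t \<le> a' + b'"
    using fin[OF y(2)] by blast
  have "u *\<^sub>R (x, a) + v *\<^sub>R (y, a') \<in> {(x, t). x \<in> S \<and> ereal t \<le> g x}"
    using assms(1) x(1) y(1) ab(1) ab'(1) uv
    by (intro convexD) (auto simp: ereal_concave_on_def)
  then have 1: "u *\<^sub>R x + v *\<^sub>R y \<in> S" "ereal (u * a + v * a') \<le> g (u *\<^sub>R x + v *\<^sub>R y)" by auto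
  have "u *\<^sub>R (x, b) + v *\<^sub>R (y, b') \<in> {(x, t). x \<in> S \<and> ereal t \<le> k x}"
    using assms(2) x(1) y(1) ab(2) ab'(2) uv
    by (intro convexD) (auto simp: ereal_concave_on_def)
  then have 2: "ereal (u * b + v * b') \<le> k (u *\<^sub>R x + v *\<^sub>R y)" by auto
  have "u * s + v * t \<le> u * (a + b) + v * (a' + b')"
    using ab(3) ab'(3) uv by (intro add_mono mult_left_mono)
  then have "ereal (u * s + v * t) \<le> ereal (u * a + v * a') + ereal (u * b + v * b')"
    by (simp add: algebra_simps)
  also have "\<dots> \<le> g (u *\<^sub>R x + v *\<^sub>R y) + k (u *\<^sub>R x + v *\<^sub>R y)"
    using 1(2) 2 by (rule add_mono)
  finally show "u *\<^sub>R p + v *\<^sub>R p' \<in> {(x, t). x \<in> S \<and> ereal t \<le> g x + k x}"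
    using 1(1) p by simp
qed

lemma ereal_concave_on_subset:
  assumes "ereal_concave_on UNIV g" "convex S"
  shows "ereal_concave_on S g"
proof -
  have "{(x, t::real). x \<in> S \<and> ereal t \<le> g x} = {(x, t). x \<in> UNIV \<and> ereal t \<le> g x} \<inter> S \<times> UNIV"
    by auto
  with assms show ?thesis
    by (auto simp: ereal_concave_on_def simp del: UNIV_I intro!: convex_Int convex_Times)
qed

section \<open>Marginals of linear programs over closed convex sets\<close>

definition marginal :: "('a \<times> 'b) set \<Rightarrow> ('a \<times> 'b \<Rightarrow> real) \<Rightarrow> 'a \<Rightarrow> ereal" where
  "marginal P l x = Sup {ereal (l (x, y)) | y. (x, y) \<in> P}"

text \<open>Parametric linear programs. Boundedness is required only over bounded sets of parameters:
  this coercivity is what keeps the projection of \<open>P\<close> to the parameters well behaved while \<open>P\<close>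
  itself may be unbounded.\<close>

locale tame_program =
  fixes P :: "('a::euclidean_space \<times> 'b::euclidean_space) set" and l :: "'a \<times> 'b \<Rightarrow> real"
  assumes closed_P: "closed P" and convex_P: "convex P"
    and bounded_fibres: "\<And>r. bounded {p \<in> P. norm (fst p) \<le> r}"
    and linear_l: "linear l"
begin

lemma continuous_l: "continuous_on S l"
  using linear_l by (simp add: linear_continuous_on linear_linear)

lemma compact_part: "compact {p \<in> P. norm (fst p) \<le> r}"
proof -
  have "closed {p::'a \<times> 'b. norm (fst p) \<le> r}"
    by (intro closed_Collect_le continuous_intros)
  then show ?thesis using closed_P bounded_fibres[of r]
    by (simp add: compact_eq_bounded_closed Collect_conj_eq closed_Int)
qed

text \<open>The supremum is attained because the fibres are compact, which turns the hypograph of the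
  marginal into a projection of a closed convex set.\<close>

lemma le_marginal_iff: "ereal t \<le> marginal P l x \<longleftrightarrow> (\<exists>y. (x, y) \<in> P \<and> t \<le> l (x, y))"
proof
  assume t: "ereal t \<le> marginal P l x"
  let ?F = "{p \<in> P. norm (fst p) \<le> norm x} \<inter> {x} \<times> UNIV"
  have "?F \<noteq> {}"
  proof
    assume "?F = {}"
    then have "{ereal (l (x, y)) | y. (x, y) \<in> P} = {}" by auto
    with t show False unfolding marginal_def by (simp only: Sup_empty) (simp add: bot_ereal_def)
  qed
  moreover have "compact ?F"
    by (intro compact_Int_closed compact_part closed_Times) auto
  ultimately have "\<exists>p\<in>?F. \<forall>q\<in>?F. l q \<le> l p"
    by (intro continuous_attains_sup continuous_l)
  then obtain p where p: "p \<in> ?F" "\<And>q. q \<in> ?F \<Longrightarrow> l q \<le> l p" by blast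
  have "marginal P l x \<le> ereal (l p)"
    unfolding marginal_def using p(2) by (intro Sup_least) auto
  with t have "t \<le> l p" by (meson ereal_less_eq(3) order_trans)
  with p(1) show "\<exists>y. (x, y) \<in> P \<and> t \<le> l (x, y)" by auto
next
  assume "\<exists>y. (x, y) \<in> P \<and> t \<le> l (x, y)"
  then obtain y where y: "(x, y) \<in> P" "t \<le> l (x, y)" by blast
  then have "ereal (l (x, y)) \<le> marginal P l x"
    unfolding marginal_def by (intro Sup_upper) auto
  with y(2) show "ereal t \<le> marginal P l x" by (meson ereal_less_eq(3) order_trans)
qed

lemma marginal_less_PInf: "marginal P l x < \<infinity>"
proof (rule ccontr)
  assume "\<not> marginal P l x < \<infinity>"
  then have inf: "\<exists>y. (x, y) \<in> P \<and> t \<le> l (x, y)" for t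
    by (simp add: le_marginal_iff[symmetric])
  have "bounded (l ` {p \<in> P. norm (fst p) \<le> norm x})"
    using compact_part by (intro compact_imp_bounded compact_continuous_image continuous_l)
  then obtain c where c: "\<And>p. p \<in> P \<Longrightarrow> norm (fst p) \<le> norm x \<Longrightarrow> \<bar>l p\<bar> \<le> c"
    unfolding bounded_iff by (metis (mono_tags, lifting) imageI mem_Collect_eq real_norm_def)
  obtain y where "(x, y) \<in> P" "c + 1 \<le> l (x, y)" using inf by blast
  with c[of "(x, y)"] show False by auto
qed

text \<open>The hypograph is the image of the convex set of all \<open>(x, y, t)\<close> with \<open>(x, y) \<in> P\<close> and
  \<open>t \<le> l (x, y)\<close>.\<close>

lemma marginal_concave: "ereal_concave_on UNIV (marginal P l)"
  unfolding ereal_concave_on_def le_marginal_iff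
proof (rule convexI)
  fix p p' and u v :: real
  assume "p \<in> {(x, t). x \<in> UNIV \<and> (\<exists>y. (x, y) \<in> P \<and> t \<le> l (x, y))}"
    "p' \<in> {(x, t). x \<in> UNIV \<and> (\<exists>y. (x, y) \<in> P \<and> t \<le> l (x, y))}"
    and uv: "0 \<le> u" "0 \<le> v" "u + v = 1"
  then obtain x s y x' s' y' where p: "p = (x, s)" "p' = (x', s')"
    and *: "(x, y) \<in> P" "s \<le> l (x, y)" "(x', y') \<in> P" "s' \<le> l (x', y')"
    by blast
  have P: "u *\<^sub>R (x, y) + v *\<^sub>R (x', y') \<in> P" using * uv convex_P by (intro convexD)
  have "u * s + v * s' \<le> u * l (x, y) + v * l (x', y')"
    using * uv by (intro add_mono mult_left_mono)
  also have "\<dots> = l (u *\<^sub>R (x, y) + v *\<^sub>R (x', y'))"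
    using linear_l by (simp only: linear_add linear_scale real_scaleR_def)
  finally show "u *\<^sub>R p + v *\<^sub>R p' \<in>
      {(x, t). x \<in> UNIV \<and> (\<exists>y. (x, y) \<in> P \<and> t \<le> l (x, y))}"
    using P p by auto
qed

text \<open>A convergent sequence of parameters stays in a ball, over which the program is compact; so
  the superlevel sets are closed although a projection of a closed set need not be.\<close>

lemma marginal_usc: "usc (marginal P l)"
proof (rule usc_if_less_open)
  fix r
  let ?S = "{x. ereal r \<le> marginal P l x}"
  have "closed ?S"
    unfolding closed_sequential_limits
  proof (intro allI impI, elim conjE)
    fix X x assume X: "\<forall>n. X n \<in> ?S" "X \<longlonglongrightarrow> x"
    obtain c where c: "\<And>n. norm (X n) \<le> c"
      using convergent_imp_bounded[OF X(2)] by (auto simp: bounded_iff)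
    let ?K = "fst ` ({p \<in> P. norm (fst p) \<le> c} \<inter> {p. r \<le> l p})"
    have "closed {p. r \<le> l p}" by (intro closed_Collect_le continuous_intros continuous_l)
    then have "compact ?K"
      by (intro compact_continuous_image compact_Int_closed compact_part continuous_intros)
    moreover have "X n \<in> ?K" for n
    proof -
      obtain y where "(X n, y) \<in> P" "r \<le> l (X n, y)"
        using X(1) le_marginal_iff by blast
      then show ?thesis using c by force
    qed
    ultimately have "x \<in> ?K" using X(2) compact_imp_closed closed_sequentially by blast
    then show "x \<in> ?S" by (auto simp: le_marginal_iff)
  qed
  moreover have "{x. marginal P l x < ereal r} = - ?S" by auto
  ultimately show "open {x. marginal P l x < ereal r}" by (metis open_Compl)
qed

end

section \<open>Block matrices\<close>

definition cons_vec :: "real \<Rightarrow> real^'d \<Rightarrow> real^('d option)" where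
  "cons_vec s v = (\<chi> i. case i of None \<Rightarrow> s | Some k \<Rightarrow> v $ k)"

definition outer :: "real^'n \<Rightarrow> real^'q \<Rightarrow> real^'q^'n" where
  "outer x u = (\<chi> i j. x $ i * u $ j)"

lemma sum_UNIV_option: "(\<Sum>i\<in>UNIV. f i) = f None + (\<Sum>k\<in>UNIV. f (Some k))"
  for f :: "'d::finite option \<Rightarrow> 'b::comm_monoid_add"
  by (simp add: UNIV_option_conv sum.reindex)

lemma sum_UNIV_plus: "(\<Sum>i\<in>UNIV. f i) = (\<Sum>k\<in>UNIV. f (Inl k)) + (\<Sum>k\<in>UNIV. f (Inr k))"
  for f :: "'c::finite + 'd::finite \<Rightarrow> 'b::comm_monoid_add"
  unfolding UNIV_Plus_UNIV[symmetric] by (subst sum.Plus) auto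

lemma inner_cons_vec: "cons_vec s v \<bullet> cons_vec t w = s * t + v \<bullet> w"
  by (simp add: inner_vec_def cons_vec_def sum_UNIV_option)

lemma inner_join: "join u x \<bullet> join w z = u \<bullet> w + x \<bullet> z"
  by (simp add: inner_vec_def join_def sum_UNIV_plus)

lemma bordered_mult: "bordered x X *v cons_vec s v = cons_vec (s + x \<bullet> v) (s *\<^sub>R x + X *v v)"
  by (auto simp: vec_eq_iff matrix_vector_mult_def bordered_def cons_vec_def sum_UNIV_option
      inner_vec_def split: option.split)

lemma block_mat_mult:
  "block_mat W \<Psi> X *v join w z = join (W *v w + transpose \<Psi> *v z) (\<Psi> *v w + X *v z)"
  by (auto simp: vec_eq_iff matrix_vector_mult_def block_mat_def join_def sum_UNIV_plus
      split: sum.split)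

text \<open>An affine function of \<open>(u, W)\<close> is an inner product with a fixed bordered matrix. With equal
  arguments this also bounds \<open>u\<close> and \<open>W\<close> by the norm of the bordered matrix.\<close>

lemma inner_bordered: "bordered d C \<bullet> bordered u W = 1 + 2 * (d \<bullet> u) + C \<bullet> W"
  by (simp add: inner_vec_def bordered_def sum_UNIV_option sum.distrib)

lemma frob_eq_inner: "frob M N = M \<bullet> N"
  by (simp add: frob_def trace_def matrix_matrix_mult_def transpose_def inner_vec_def)
    (rule sum.swap)

lemma inner_transpose_outer: "transpose B \<bullet> outer x u = u \<bullet> (B *v x)"
proof -
  have "transpose B \<bullet> outer x u = (\<Sum>i\<in>UNIV. \<Sum>j\<in>UNIV. u $ j * (B $ j $ i * x $ i))"
    by (simp add: inner_vec_def transpose_def outer_def mult_ac)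
  also have "\<dots> = u \<bullet> (B *v x)"
    by (subst sum.swap) (simp add: inner_vec_def matrix_vector_mult_def sum_distrib_left)
  finally show ?thesis .
qed

lemma inner_outer_square:
  assumes "A \<in> sym_mats" shows "A \<bullet> outer_square x = x \<bullet> (A *v x)"
  using inner_transpose_outer[of A x x] assms
  by (simp add: sym_mats_def outer_def outer_square_def)

lemma outer_mult: "outer x u *v w = (u \<bullet> w) *\<^sub>R x"
  by (simp add: vec_eq_iff outer_def matrix_vector_mult_def inner_vec_def sum_distrib_left
      sum_distrib_right mult_ac)

lemma outer_square_eq_outer: "outer_square x = outer x x"
  by (simp add: outer_def outer_square_def)

lemma outer_square_lift_vec: "outer_square (lift_vec y) = bordered y (outer_square y)"
  by (auto simp: vec_eq_iff outer_square_def lift_vec_def bordered_def split: option.split)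

lemma outer_square_join:
  "outer_square (join u x) = block_mat (outer_square u) (outer x u) (outer_square x)"
  by (auto simp: vec_eq_iff outer_square_def outer_def join_def block_mat_def transpose_def
      split: sum.split)

lemma outer_square_sym: "outer_square x \<in> sym_mats"
  by (simp add: sym_mats_def outer_square_def transpose_def vec_eq_iff mult.commute)

lemma lifted_in_G: "y \<in> F \<Longrightarrow> bordered y (outer_square y) \<in> \<G> F"
  unfolding \<G>_def outer_square_lift_vec by (intro subsetD[OF closure_subset] hull_inc) auto

lemma bordered_inject: "bordered x X = bordered y Y \<longleftrightarrow> x = y \<and> X = Y"
proof
  assume *: "bordered x X = bordered y Y"
  have "x $ k = y $ k" for k
    using arg_cong[OF *, of "\<lambda>M. M $ None $ Some k"] by (simp add: bordered_def)
  moreover have "X $ k $ j = Y $ k $ j" for k j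
    using arg_cong[OF *, of "\<lambda>M. M $ Some k $ Some j"] by (simp add: bordered_def)
  ultimately show "x = y \<and> X = Y" by (simp add: vec_eq_iff)
qed simp

lemma bordered_combination:
  assumes "s + t = 1"
  shows "bordered (s *\<^sub>R x + t *\<^sub>R y) (s *\<^sub>R X + t *\<^sub>R Y) = s *\<^sub>R bordered x X + t *\<^sub>R bordered y Y"
  using assms by (auto simp: vec_eq_iff bordered_def split: option.split)

lemma join_combination:
  "join (s *\<^sub>R u + t *\<^sub>R u') (s *\<^sub>R x + t *\<^sub>R x') = s *\<^sub>R join u x + t *\<^sub>R join u' x'"
  by (auto simp: vec_eq_iff join_def split: sum.split)

lemma block_mat_combination:
  "block_mat (s *\<^sub>R W + t *\<^sub>R W') (s *\<^sub>R \<Psi> + t *\<^sub>R \<Psi>') (s *\<^sub>R X + t *\<^sub>R X') =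
    s *\<^sub>R block_mat W \<Psi> X + t *\<^sub>R block_mat W' \<Psi>' X'"
  by (auto simp: vec_eq_iff block_mat_def transpose_def split: sum.split)

lemma sym_mats_combination:
  "X \<in> sym_mats \<Longrightarrow> Y \<in> sym_mats \<Longrightarrow> s *\<^sub>R X + t *\<^sub>R Y \<in> sym_mats"
  by (simp add: sym_mats_def transpose_def vec_eq_iff)

lemma continuous_on_transpose [continuous_intros]:
  "continuous_on S f \<Longrightarrow> continuous_on S (\<lambda>x. transpose (f x))"
  unfolding transpose_def by (intro continuous_intros)

lemma closed_sym_mats: "closed sym_mats"
  unfolding sym_mats_def by (intro closed_Collect_eq continuous_intros)

lemma continuous_on_bordered [continuous_intros]:
  assumes "continuous_on S f" "continuous_on S g"
  shows "continuous_on S (\<lambda>p. bordered (f p) (g p))"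
  unfolding bordered_def
proof (intro continuous_intros)
  fix i j :: "'b option"
  show "continuous_on S (\<lambda>p. case i of
       None \<Rightarrow> (case j of None \<Rightarrow> 1 | Some l \<Rightarrow> f p $ l)
     | Some k \<Rightarrow> (case j of None \<Rightarrow> f p $ k | Some l \<Rightarrow> g p $ k $ l))"
    using assms by (cases i; cases j) (auto intro!: continuous_intros)
qed

lemma continuous_on_join [continuous_intros]:
  assumes "continuous_on S f" "continuous_on S g"
  shows "continuous_on S (\<lambda>p. join (f p) (g p))"
  unfolding join_def
proof (intro continuous_intros)
  fix i :: "'b + 'c"
  show "continuous_on S (\<lambda>p. case i of Inl k \<Rightarrow> f p $ k | Inr k \<Rightarrow> g p $ k)"
    using assms by (cases i) (auto intro!: continuous_intros)
qed

lemma continuous_on_block_mat [continuous_intros]: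
  assumes "continuous_on S f" "continuous_on S g" "continuous_on S k"
  shows "continuous_on S (\<lambda>p. block_mat (f p) (g p) (k p))"
  unfolding block_mat_def transpose_def
proof (intro continuous_intros)
  fix i j :: "'b + 'c"
  show "continuous_on S (\<lambda>p. case i of
       Inl m \<Rightarrow> (case j of Inl l \<Rightarrow> f p $ m $ l | Inr l \<Rightarrow> (\<chi> a b. g p $ b $ a) $ m $ l)
     | Inr m \<Rightarrow> (case j of Inl l \<Rightarrow> g p $ m $ l | Inr l \<Rightarrow> k p $ m $ l))"
    using assms by (cases i; cases j) (auto intro!: continuous_intros)
qed

lemma norm_bordered_ge: "norm u \<le> norm (bordered u W)" "norm W \<le> norm (bordered u W)"
  by (auto simp: norm_eq_sqrt_inner inner_bordered)

section \<open>Consequences of positive semidefiniteness\<close>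

lemma closed_psd_mats: "closed psd_mats"
proof -
  have "closed {M::real^'a^'a. 0 \<le> v \<bullet> (M *v v)}" for v
    unfolding matrix_vector_mult_def by (intro closed_Collect_le continuous_intros)
  then have "closed (sym_mats \<inter> (\<Inter>v. {M::real^'a^'a. 0 \<le> v \<bullet> (M *v v)}))"
    by (intro closed_Int closed_sym_mats closed_INT ballI)
  moreover have "psd_mats = sym_mats \<inter> (\<Inter>v. {M::real^'a^'a. 0 \<le> v \<bullet> (M *v v)})"
    by (auto simp: psd_mats_def)
  ultimately show ?thesis by simp
qed

text \<open>The quadratic form at the vector with blocks \<open>s\<close>, \<open>w\<close>, \<open>z\<close>; the
  matrix inequalities that follow are choices of these blocks.\<close>

lemma psd_quadratic_form:
  assumes "bordered (join u x) (block_mat W \<Psi> X) \<in> psd_mats"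
  shows "0 \<le> s\<^sup>2 + 2 * s * (u \<bullet> w + x \<bullet> z) + w \<bullet> (W *v w) + 2 * (z \<bullet> (\<Psi> *v w)) + z \<bullet> (X *v z)"
proof -
  let ?v = "cons_vec s (join w z)"
  have "w \<bullet> (transpose \<Psi> *v z) = z \<bullet> (\<Psi> *v w)"
    by (metis dot_lmul_matrix inner_commute transpose_matrix_vector)
  moreover have "0 \<le> ?v \<bullet> (bordered (join u x) (block_mat W \<Psi> X) *v ?v)"
    using assms by (simp add: psd_mats_def)
  ultimately show ?thesis
    by (simp add: bordered_mult block_mat_mult inner_cons_vec inner_join inner_simps
        power2_eq_square algebra_simps inner_commute)
qed

lemma psd_lower_block:
  assumes "bordered (join u x) (block_mat W \<Psi> X) \<in> psd_mats" "X \<in> sym_mats"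
  shows "X \<in> psd_mats"
  using psd_quadratic_form[OF assms(1), of 0 0] assms(2) by (simp add: psd_mats_def)

text \<open>The Schur complement with respect to the leading entry: in the quadratic form the leading
  coordinate is chosen as \<open>- (x \<bullet> z)\<close>, its minimizer.\<close>

lemma psd_Schur_complement:
  assumes "bordered (join u x) (block_mat W \<Psi> X) \<in> psd_mats" "X \<in> sym_mats"
  shows "X - outer_square x \<in> psd_mats"
proof -
  have "X - outer_square x \<in> sym_mats"
    using sym_mats_combination[OF assms(2) outer_square_sym[of x], of 1 "-1"] by simp
  moreover have "0 \<le> z \<bullet> ((X - outer_square x) *v z)" for z
    using psd_quadratic_form[OF assms(1), of "- (x \<bullet> z)" 0 z]
    by (simp add: outer_square_eq_outer matrix_vector_mult_diff_rdistrib outer_mult inner_simps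
        power2_eq_square inner_commute)
  ultimately show ?thesis by (simp add: psd_mats_def)
qed

lemma psd_off_diagonal_entry:
  assumes "bordered (join u x) (block_mat W \<Psi> X) \<in> psd_mats"
  shows "\<bar>\<Psi> $ i $ j\<bar> \<le> norm W + norm X"
proof -
  have entry: "axis k 1 \<bullet> (M *v axis l 1) = M $ k $ l" for M :: "real^'c^'d" and k l
    by (simp add: inner_axis' matrix_vector_mult_basis column_def)
  have norm: "\<bar>M $ k $ l\<bar> \<le> norm M" for M :: "real^'c^'d" and k l
    using component_le_norm_cart[of "M $ k" l] Finite_Cartesian_Product.norm_nth_le[of M k] by simp
  have "0 \<le> W $ j $ j + 2 * \<Psi> $ i $ j + X $ i $ i"
    using psd_quadratic_form[OF assms, of 0 "axis j 1" "axis i 1"] by (simp add: entry)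
  moreover have "0 \<le> W $ j $ j - 2 * \<Psi> $ i $ j + X $ i $ i"
    using psd_quadratic_form[OF assms, of 0 "axis j 1" "- axis i 1"]
    by (simp add: entry linear_neg[OF matrix_vector_mul_linear])
  ultimately show ?thesis using norm[of W j j] norm[of X i i] by linarith
qed

text \<open>Once the lower block has zero Schur complement, the quadratic form with minimizing leading
  coordinate is affine in \<open>z\<close>; being nonnegative, it cannot depend on \<open>z\<close>.\<close>

lemma psd_off_diagonal_forced:
  assumes "bordered (join u x) (block_mat W \<Psi> (outer_square x)) \<in> psd_mats"
  shows "\<Psi> = outer x u"
proof -
  have "(\<Psi> - outer x u) *v w = 0" for w
  proof (rule ccontr)
    define d where "d = (\<Psi> - outer x u) *v w"
    assume "(\<Psi> - outer x u) *v w \<noteq> 0"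
    then have d: "0 < d \<bullet> d" by (simp add: d_def)
    define q where "q = w \<bullet> (W *v w) - (u \<bullet> w)\<^sup>2"
    have nonneg: "0 \<le> q + 2 * (z \<bullet> d)" for z
      using psd_quadratic_form[OF assms, of "- (u \<bullet> w + x \<bullet> z)" w z]
      by (simp add: q_def d_def outer_square_eq_outer matrix_vector_mult_diff_rdistrib outer_mult
          inner_simps power2_eq_square algebra_simps inner_commute)
    \<comment> \<open>Moving \<open>z\<close> far enough against \<open>d\<close> makes the affine function negative.\<close>
    define r where "r = (\<bar>q\<bar> + 1) / (d \<bullet> d)"
    have "r * (d \<bullet> d) = \<bar>q\<bar> + 1" using d by (simp add: r_def)
    with nonneg[of "- r *\<^sub>R d"] show False by simp
  qed
  then have "\<Psi> - outer x u = 0" by (simp add: matrix_eq)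
  then show ?thesis by simp
qed

section \<open>Linear maps on symmetric and semidefinite matrices\<close>

text \<open>Extension along the symmetrization \<open>X \<mapsto> (X + transpose X) / 2\<close>. It makes a map that is
  linear on symmetric matrices only accessible to the theory of linear maps on whole spaces, in
  particular to continuity.\<close>

lemma linear_on_sym_mats_extension:
  fixes L :: "(real^'n^'n) \<times> (real^'n) \<Rightarrow> 'c::real_vector"
  assumes "linear_on_subspace (sym_mats \<times> UNIV) L"
  obtains K where "linear K" "\<And>X x. X \<in> sym_mats \<Longrightarrow> K (X, x) = L (X, x)"
proof
  define S :: "real^'n^'n \<Rightarrow> real^'n^'n" where "S X = (1/2) *\<^sub>R (X + transpose X)" for X
  define K where "K p = L (S (fst p), snd p)" for p
  have sym: "S X \<in> sym_mats" for X
    by (simp add: S_def sym_mats_def transpose_def vec_eq_iff)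
  have add: "S (X + Y) = S X + S Y" and scale: "S (r *\<^sub>R X) = r *\<^sub>R S X" for X Y r
    by (simp_all add: S_def transpose_def vec_eq_iff algebra_simps)
  show "linear K"
  proof (rule linearI)
    show "K (p + q) = K p + K q" for p q
      using assms sym by (simp add: K_def linear_on_subspace_def add flip: add_Pair)
    show "K (r *\<^sub>R p) = r *\<^sub>R K p" for r p
      using assms sym by (simp add: K_def linear_on_subspace_def scale flip: scaleR_Pair)
  qed
  show "K (X, x) = L (X, x)" if "X \<in> sym_mats" for X x
  proof -
    have "S X = X" using that by (simp add: S_def sym_mats_def flip: scaleR_2)
    then show ?thesis by (simp add: K_def)
  qed
qed

text \<open>By compactness of the unit sphere of the cone, injectivity on rays of the cone
  is quantitative.\<close>

lemma psd_kernel_trivial_bound: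
  fixes K :: "real^'n^'n \<Rightarrow> 'c::real_normed_vector"
  assumes lin: "linear K" and ker: "\<And>X. X \<in> psd_mats \<Longrightarrow> K X = 0 \<Longrightarrow> X = 0"
  obtains \<delta> where "0 < \<delta>" "\<And>X. X \<in> psd_mats \<Longrightarrow> \<delta> * norm X \<le> norm (K X)"
proof -
  let ?S = "sphere 0 1 \<inter> psd_mats :: (real^'n^'n) set"
  have normalized: "(1 / norm X) *\<^sub>R X \<in> ?S" if "X \<in> psd_mats" "X \<noteq> 0" for X :: "real^'n^'n"
    using that by (auto simp: psd_mats_def sym_mats_def transpose_def vec_eq_iff
        scaleR_matrix_vector_assoc[symmetric])
  have "\<exists>\<delta>>0. \<forall>X\<in>?S. \<delta> \<le> norm (K X)"
  proof (cases "?S = {}")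
    case False
    have "continuous_on ?S (\<lambda>X. norm (K X))"
      using lin by (intro continuous_on_norm linear_continuous_on) (simp add: linear_linear)
    moreover have "compact ?S" by (intro compact_Int_closed compact_sphere closed_psd_mats)
    ultimately obtain X where "X \<in> ?S" "\<forall>Y\<in>?S. norm (K X) \<le> norm (K Y)"
      using continuous_attains_inf[OF _ False] by blast
    moreover from this ker have "K X \<noteq> 0" by fastforce
    ultimately show ?thesis by (intro exI[of _ "norm (K X)"]) auto
  qed (auto intro: exI[of _ 1])
  then obtain \<delta> where \<delta>: "0 < \<delta>" "\<And>X. X \<in> ?S \<Longrightarrow> \<delta> \<le> norm (K X)" by blast
  have "\<delta> * norm X \<le> norm (K X)" if "X \<in> psd_mats" for X
  proof (cases "X = 0")
    case False
    with \<delta>(2)[OF normalized[OF that False]] show ?thesis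
      using lin by (simp add: linear_scale field_simps)
  qed simp
  with \<delta>(1) show thesis by (rule that)
qed

section \<open>The lifted program\<close>

definition feasible ::
  "(real^(('q + 'n) option)^(('q + 'n) option)) set \<Rightarrow>
   ((real^'n^'n) \<times> (real^'n) \<Rightarrow> real^'m) \<Rightarrow> real^'m \<Rightarrow> (real^('q option)^('q option)) set \<Rightarrow>
   ((real^'n) \<times> (real^'q^'n) \<times> (real^'q) \<times> (real^'q^'q) \<times> (real^'n^'n)) set" where
  "feasible \<C> \<A> b GU = {(x, \<Psi>, u, W, X). W \<in> sym_mats \<and> X \<in> sym_mats \<and>
     bordered (join u x) (block_mat W \<Psi> X) \<in> \<C> \<and> bordered u W \<in> GU \<and> \<A> (X, x) = b}"

definition objective ::
  "real^'n^'n \<Rightarrow> real^'n \<Rightarrow> real^'n^'q \<Rightarrow> real^'q^'q \<Rightarrow> real^'q \<Rightarrow>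
   (real^'n) \<times> (real^'q^'n) \<times> (real^'q) \<times> (real^'q^'q) \<times> (real^'n^'n) \<Rightarrow> real" where
  "objective A a B C c = (\<lambda>(x, \<Psi>, u, W, X).
     frob A X + 2 * (a \<bullet> x) + 2 * frob (transpose B) \<Psi> + frob C W + 2 * (c \<bullet> u))"

lemma relaxation_eq_marginal:
  "relaxation h A a B C c \<C> \<A> b GU x =
    h x + marginal (feasible \<C> \<A> b GU) (objective A a B C c) x"
proof -
  have "{ereal (frob A X + 2 * (a \<bullet> x) + 2 * frob (transpose B) \<Psi> + frob C U + 2 * (c \<bullet> u))
      | \<Psi> u U X. U \<in> sym_mats \<and> X \<in> sym_mats \<and>
        bordered (join u x) (block_mat U \<Psi> X) \<in> \<C> \<and> bordered u U \<in> GU \<and> \<A> (X, x) = b} =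
    {ereal (objective A a B C c (x, y)) | y. (x, y) \<in> feasible \<C> \<A> b GU}"
    unfolding objective_def feasible_def by force
  then show ?thesis by (simp add: relaxation_def marginal_def)
qed

lemma linear_objective: "linear (objective A a B C c)"
  by (rule linearI) (auto simp: objective_def frob_eq_inner inner_simps algebra_simps)

locale lifted_program =
  fixes \<C> :: "(real^(('q::finite + 'n::finite) option)^(('q + 'n) option)) set"
    and \<A> :: "(real^'n^'n) \<times> (real^'n) \<Rightarrow> real^'m::finite" and b :: "real^'m"
    and GU :: "(real^('q option)^('q option)) set"
  assumes closed_C: "closed \<C>" and convex_C: "convex \<C>" and C_psd: "\<C> \<subseteq> psd_mats"
    and A_linear: "linear_on_subspace (sym_mats \<times> UNIV) \<A>"
    and A_kernel: "{X \<in> psd_mats. \<A> (X, 0) = 0} = {0}"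
    and compact_GU: "compact GU" and convex_GU: "convex GU"
begin

lemma closed_feasible: "closed (feasible \<C> \<A> b GU)"
proof -
  obtain K where K: "linear K" "\<And>X x. X \<in> sym_mats \<Longrightarrow> K (X, x) = \<A> (X, x)"
    using linear_on_sym_mats_extension[OF A_linear] by blast
  let ?x = "\<lambda>p::(real^'n) \<times> (real^'q^'n) \<times> (real^'q) \<times> (real^'q^'q) \<times> (real^'n^'n). fst p"
  let ?\<Psi> = "\<lambda>p::(real^'n) \<times> (real^'q^'n) \<times> (real^'q) \<times> (real^'q^'q) \<times> (real^'n^'n). fst (snd p)"
  let ?u = "\<lambda>p::(real^'n) \<times> (real^'q^'n) \<times> (real^'q) \<times> (real^'q^'q) \<times> (real^'n^'n).
    fst (snd (snd p))"
  let ?W = "\<lambda>p::(real^'n) \<times> (real^'q^'n) \<times> (real^'q) \<times> (real^'q^'q) \<times> (real^'n^'n).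
    fst (snd (snd (snd p)))"
  let ?X = "\<lambda>p::(real^'n) \<times> (real^'q^'n) \<times> (real^'q) \<times> (real^'q^'q) \<times> (real^'n^'n).
    snd (snd (snd (snd p)))"
  have "continuous_on UNIV (\<lambda>p. K (?X p, ?x p))"
    by (rule continuous_on_compose2[OF linear_continuous_on[of K UNIV]])
      (use K(1) in \<open>auto simp: linear_linear intro!: continuous_intros\<close>)
  then have "closed ((?W -` sym_mats) \<inter> (?X -` sym_mats) \<inter>
    ((\<lambda>p. bordered (join (?u p) (?x p)) (block_mat (?W p) (?\<Psi> p) (?X p))) -` \<C>) \<inter>
    ((\<lambda>p. bordered (?u p) (?W p)) -` GU) \<inter> ((\<lambda>p. K (?X p, ?x p)) -` {b}))"
    using closed_C compact_imp_closed[OF compact_GU]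
    by (intro closed_Int closed_vimage closed_sym_mats closed_singleton continuous_intros)
  moreover have "feasible \<C> \<A> b GU = (?W -` sym_mats) \<inter> (?X -` sym_mats) \<inter>
    ((\<lambda>p. bordered (join (?u p) (?x p)) (block_mat (?W p) (?\<Psi> p) (?X p))) -` \<C>) \<inter>
    ((\<lambda>p. bordered (?u p) (?W p)) -` GU) \<inter> ((\<lambda>p. K (?X p, ?x p)) -` {b})"
    using K(2) by (auto simp: feasible_def)
  ultimately show ?thesis by simp
qed

lemma convex_feasible: "convex (feasible \<C> \<A> b GU)"
proof (rule convexI)
  fix p p' and s t :: real
  assume p: "p \<in> feasible \<C> \<A> b GU" "p' \<in> feasible \<C> \<A> b GU"
    and st: "0 \<le> s" "0 \<le> t" "s + t = 1"
  obtain x \<Psi> u W X where P: "p = (x, \<Psi>, u, W, X)" by (cases p)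
  obtain x' \<Psi>' u' W' X' where P': "p' = (x', \<Psi>', u', W', X')" by (cases p')
  have sym: "X \<in> sym_mats" "X' \<in> sym_mats" "W \<in> sym_mats" "W' \<in> sym_mats"
    and A: "\<A> (X, x) = b" "\<A> (X', x') = b"
    using p by (auto simp: feasible_def P P')
  obtain K where K: "linear K" "\<And>X x. X \<in> sym_mats \<Longrightarrow> K (X, x) = \<A> (X, x)"
    using linear_on_sym_mats_extension[OF A_linear] by blast
  have "\<A> (s *\<^sub>R X + t *\<^sub>R X', s *\<^sub>R x + t *\<^sub>R x') = K (s *\<^sub>R (X, x) + t *\<^sub>R (X', x'))"
    using K(2)[OF sym_mats_combination[OF sym(1,2)]] by simp
  also have "\<dots> = s *\<^sub>R b + t *\<^sub>R b"
    using K sym A by (simp only: linear_add linear_scale)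
  also have "\<dots> = b" using st by (simp flip: scaleR_left_distrib)
  finally have "\<A> (s *\<^sub>R X + t *\<^sub>R X', s *\<^sub>R x + t *\<^sub>R x') = b" .
  moreover have "s *\<^sub>R bordered u W + t *\<^sub>R bordered u' W' \<in> GU"
    using p st by (intro convexD[OF convex_GU]) (auto simp: feasible_def P P')
  moreover have "s *\<^sub>R bordered (join u x) (block_mat W \<Psi> X) +
      t *\<^sub>R bordered (join u' x') (block_mat W' \<Psi>' X') \<in> \<C>"
    using p st by (intro convexD[OF convex_C]) (auto simp: feasible_def P P')
  ultimately show "s *\<^sub>R p + t *\<^sub>R p' \<in> feasible \<C> \<A> b GU"
    using sym st
    by (simp add: P P' feasible_def bordered_combination join_combination block_mat_combination
        sym_mats_combination)
qed

text \<open>Each block is bounded for its own reason: \<open>u\<close> and \<open>W\<close> by compactness of \<open>GU\<close>, \<open>X\<close> because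
  the equation \<open>\<A> (X, x) = b\<close> bounds the image of \<open>X\<close> under a map that does not annihilate any
  ray of the cone, and the off-diagonal block by the diagonal ones.\<close>

lemma bounded_feasible: "bounded {p \<in> feasible \<C> \<A> b GU. norm (fst p) \<le> r}"
proof -
  obtain K where K: "linear K" "\<And>X x. X \<in> sym_mats \<Longrightarrow> K (X, x) = \<A> (X, x)"
    using linear_on_sym_mats_extension[OF A_linear] by blast
  have "linear (\<lambda>X. K (X, 0))"
  proof (rule linearI)
    show "K (X + Y, 0) = K (X, 0) + K (Y, 0)" for X Y
      using linear_add[OF K(1), of "(X, 0)" "(Y, 0)"] by simp
    show "K (s *\<^sub>R X, 0) = s *\<^sub>R K (X, 0)" for s X
      using linear_scale[OF K(1), of s "(X, 0)"] by simp
  qed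
  moreover have "X = 0" if "X \<in> psd_mats" "K (X, 0) = 0" for X
    using that K(2) A_kernel by (auto simp: psd_mats_def)
  ultimately obtain \<delta> where \<delta>: "0 < \<delta>"
    "\<And>X. X \<in> psd_mats \<Longrightarrow> \<delta> * norm X \<le> norm (K (X, 0))"
    using psd_kernel_trivial_bound[of "\<lambda>X. K (X, 0)"] by metis
  obtain \<kappa> where \<kappa>: "0 \<le> \<kappa>" "\<And>p. norm (K p) \<le> \<kappa> * norm p"
    using linear_bounded_pos[OF K(1)] by (metis less_imp_le)
  obtain \<gamma> where \<gamma>: "\<And>M. M \<in> GU \<Longrightarrow> norm M \<le> \<gamma>"
    using compact_imp_bounded[OF compact_GU] by (auto simp: bounded_iff)
  define \<beta> where "\<beta> = (norm b + \<kappa> * r) / \<delta>"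
  define \<nu> where "\<nu> = (\<Sum>i\<in>(UNIV::'n set). \<Sum>j\<in>(UNIV::'q set). \<gamma> + \<beta>)"
  have "norm p \<le> r + (\<nu> + (\<gamma> + (\<gamma> + \<beta>)))" if p: "p \<in> feasible \<C> \<A> b GU" "norm (fst p) \<le> r" for p
  proof -
    obtain x \<Psi> u W X where P: "p = (x, \<Psi>, u, W, X)" by (cases p)
    have X: "X \<in> sym_mats" and M: "bordered (join u x) (block_mat W \<Psi> X) \<in> psd_mats"
      and uW: "bordered u W \<in> GU" and A: "\<A> (X, x) = b"
      using p C_psd by (auto simp: feasible_def P)
    have x: "norm x \<le> r" using p by (simp add: P)
    have u: "norm u \<le> \<gamma>" and W: "norm W \<le> \<gamma>"
      using norm_bordered_ge(1)[of u W] norm_bordered_ge(2)[of W u] \<gamma>[OF uW] by auto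
    have "K (X, 0) = b - K (0, x)"
      using linear_add[OF K(1), of "(X, 0)" "(0, x)"] K(2)[OF X] A by simp
    then have "norm (K (X, 0)) \<le> norm b + norm (K (0, x))" by (simp add: norm_triangle_ineq4)
    also have "norm (K (0, x)) \<le> \<kappa> * r"
      using \<kappa>(2)[of "(0, x)"] mult_left_mono[OF x \<kappa>(1)] by (simp add: norm_Pair)
    finally have "\<delta> * norm X \<le> norm b + \<kappa> * r"
      using \<delta>(2)[OF psd_lower_block[OF M X]] by simp
    then have nX: "norm X \<le> \<beta>" using \<delta>(1) by (simp add: \<beta>_def field_simps)
    have "norm \<Psi> \<le> (\<Sum>i\<in>UNIV. norm (\<Psi> $ i))" by (simp add: norm_vec_def L2_set_le_sum)
    also have "\<dots> \<le> (\<Sum>i\<in>UNIV. \<Sum>j\<in>UNIV. \<bar>\<Psi> $ i $ j\<bar>)" by (intro sum_mono norm_le_l1_cart)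
    also have "\<dots> \<le> \<nu>" unfolding \<nu>_def
      using psd_off_diagonal_entry[OF M] W nX by (intro sum_mono) (meson add_mono order_trans)
    finally have "norm \<Psi> \<le> \<nu>" .
    then show ?thesis unfolding P
      using x u W nX by (intro order_trans[OF norm_Pair_le] add_mono)
  qed
  then show ?thesis unfolding bounded_iff by blast
qed

sublocale tame_program "feasible \<C> \<A> b GU" "objective A a B C c"
  for A :: "real^'n^'n" and a B C c
  by (intro tame_program.intro closed_feasible convex_feasible bounded_feasible linear_objective)

text \<open>Over a point \<open>x\<close> at which the rank-one lifting itself satisfies the equation, the lifting is
  forced: \<open>X - outer_square x\<close> is positive semidefinite and in the kernel of \<open>\<A>\<close>, and then
  nothing but \<open>outer x u\<close> completes the matrix.\<close>

lemma feasible_rank_one: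
  assumes "(x, \<Psi>, u, W, X) \<in> feasible \<C> \<A> b GU" "\<A> (outer_square x, x) = b"
  shows "X = outer_square x" "\<Psi> = outer x u"
proof -
  have X: "X \<in> sym_mats" and M: "bordered (join u x) (block_mat W \<Psi> X) \<in> psd_mats"
    and A: "\<A> (X, x) = b"
    using assms C_psd by (auto simp: feasible_def)
  obtain K where K: "linear K" "\<And>X x. X \<in> sym_mats \<Longrightarrow> K (X, x) = \<A> (X, x)"
    using linear_on_sym_mats_extension[OF A_linear] by blast
  have psd: "X - outer_square x \<in> psd_mats" using psd_Schur_complement[OF M X] .
  have "K (X - outer_square x, 0) = K (X, x) - K (outer_square x, x)"
    using linear_diff[OF K(1), of "(X, x)" "(outer_square x, x)"] by simp
  then have "\<A> (X - outer_square x, 0) = 0"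
    using K(2)[OF X] K(2)[OF outer_square_sym] K(2)[of "X - outer_square x"] psd A assms(2)
    by (simp add: psd_mats_def)
  with psd A_kernel have "X - outer_square x = 0" by blast
  then show "X = outer_square x" by simp
  with M show "\<Psi> = outer x u" by (simp add: psd_off_diagonal_forced)
qed

end

section \<open>Linear functions on the lifted uncertainty set\<close>

lemma compact_lifted:
  assumes "compact F" shows "compact (\<G> F)"
proof -
  have "continuous_on F (\<lambda>y. outer_square (lift_vec y))"
    unfolding outer_square_lift_vec unfolding outer_square_def by (intro continuous_intros)
  with assms show ?thesis
    unfolding \<G>_def by (simp add: compact_closure compact_imp_bounded compact_convex_hull
        compact_continuous_image)
qed

text \<open>Half-spaces are closed and convex, so a linear inequality passes from the rank-one
  generators to all of \<open>\<G> F\<close>. The half-space is given by the normal vector \<open>bordered d C\<close>; its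
  leading entry shifts the bound by 1.\<close>

lemma G_linear_bound:
  assumes "\<And>y. y \<in> F \<Longrightarrow> 2 * (d \<bullet> y) + y \<bullet> (C *v y) \<le> t" "C \<in> sym_mats"
    "bordered u W \<in> \<G> F"
  shows "2 * (d \<bullet> u) + C \<bullet> W \<le> t"
proof -
  let ?H = "{M. bordered d C \<bullet> M \<le> 1 + t}"
  have "(\<lambda>y. outer_square (lift_vec y)) ` F \<subseteq> ?H"
    using assms(1,2) by (auto simp: outer_square_lift_vec inner_bordered inner_outer_square)
  then have "\<G> F \<subseteq> ?H"
    unfolding \<G>_def
    by (intro closure_minimal hull_minimal convex_halfspace_le closed_halfspace_le)
  with assms(3) show ?thesis by (auto simp: inner_bordered)
qed

lemma Greatest_attained:
  fixes \<phi> :: "'a::topological_space \<Rightarrow> real"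
  assumes "compact S" "S \<noteq> {}" "continuous_on S \<phi>"
  obtains u where "u \<in> S" "(GREATEST t. \<exists>u\<in>S. t = \<phi> u) = \<phi> u" "\<And>v. v \<in> S \<Longrightarrow> \<phi> v \<le> \<phi> u"
proof -
  obtain u where u: "u \<in> S" "\<forall>v\<in>S. \<phi> v \<le> \<phi> u"
    using continuous_attains_sup[OF assms] by blast
  then have "(GREATEST t. \<exists>u\<in>S. t = \<phi> u) = \<phi> u"
    by (intro Greatest_equality) auto
  with u that show thesis by blast
qed

section \<open>The relaxation is a concave tent\<close>

text \<open>Both choices of \<open>GU\<close> are covered at once: all that matters is that \<open>GU\<close> is a compact convex
  superset of \<open>\<G> \<U>\<close> over which the linearized inner objective does not exceed its upper bounds
  over \<open>\<U>\<close>.\<close>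

lemma relaxation_closed_proper_concave_tent:
  fixes f h :: "real^'n \<Rightarrow> ereal"
    and A :: "real^'n^'n" and a :: "real^'n"
    and B :: "real^'n^'q" and C :: "real^'q^'q" and c :: "real^'q"
    and \<U> :: "(real^'q) set" and \<X> :: "(real^'n) set"
    and \<C> :: "(real^(('q + 'n) option)^(('q + 'n) option)) set"
    and \<A> :: "(real^'n^'n) \<times> (real^'n) \<Rightarrow> real^'m" and b :: "real^'m"
  assumes h: "closed_proper_concave h"
    and U: "\<U> \<noteq> {}" "compact \<U>"
    and A: "A \<in> sym_mats" and C: "C \<in> sym_mats"
    and f: "\<And>x. f x = h x + ereal (x \<bullet> (A *v x) + 2 * (a \<bullet> x)
              + (GREATEST t. \<exists>u\<in>\<U>. t = 2 * (u \<bullet> (B *v x)) + u \<bullet> (C *v u) + 2 * (c \<bullet> u)))"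
    and f_finite: "\<And>x. x \<in> \<X> \<Longrightarrow> \<bar>f x\<bar> \<noteq> \<infinity>"
    and G_C: "\<G> (join_sets \<U> \<X>) \<subseteq> \<C>"
    and A_valid: "\<G> \<X> \<subseteq> {bordered x X | x X. bordered x X \<in> psd_mats \<and> \<A> (X, x) = b}"
    and G_GU: "\<G> \<U> \<subseteq> GU"
    and GU_bound: "\<And>x u W t. bordered u W \<in> GU \<Longrightarrow>
        (\<And>v. v \<in> \<U> \<Longrightarrow> 2 * (v \<bullet> (B *v x)) + v \<bullet> (C *v v) + 2 * (c \<bullet> v) \<le> t) \<Longrightarrow>
        2 * (u \<bullet> (B *v x)) + C \<bullet> W + 2 * (c \<bullet> u) \<le> t"
    and program: "lifted_program \<C> \<A> GU"
  shows "concave_tent \<X> f (relaxation h A a B C c \<C> \<A> b GU) \<and>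
    (\<X> \<noteq> {} \<longrightarrow> closed_proper_concave (relaxation h A a B C c \<C> \<A> b GU))"
proof -
  interpret lifted_program \<C> \<A> b GU by (rule program)
  let ?m = "marginal (feasible \<C> \<A> b GU) (objective A a B C c)"
  let ?g = "relaxation h A a B C c \<C> \<A> b GU"
  have g: "?g = (\<lambda>x. h x + ?m x)" by (simp add: relaxation_eq_marginal fun_eq_iff)
  have h_less: "h x < \<infinity>" for x using h by (simp add: closed_proper_concave_def)
  have concave: "ereal_concave_on UNIV ?g"
    unfolding g using h
    by (intro ereal_concave_on_add marginal_concave h_less marginal_less_PInf)
      (simp add: closed_proper_concave_def)
  have usc: "usc ?g"
    unfolding g using h
    by (intro usc_add marginal_usc h_less marginal_less_PInf)
      (simp add: closed_proper_concave_def)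
  have less: "?g x < \<infinity>" for x
    using h_less[of x] marginal_less_PInf[of A a B C c x] by (simp add: g)
  have tent: "?g x = f x" if x: "x \<in> \<X>" for x
  proof -
    let ?\<phi> = "\<lambda>u. 2 * (u \<bullet> (B *v x)) + u \<bullet> (C *v u) + 2 * (c \<bullet> u)"
    have "continuous_on \<U> ?\<phi>"
      unfolding matrix_vector_mult_def by (intro continuous_intros)
    with U obtain u where u: "u \<in> \<U>" "(GREATEST t. \<exists>u\<in>\<U>. t = ?\<phi> u) = ?\<phi> u"
      "\<And>v. v \<in> \<U> \<Longrightarrow> ?\<phi> v \<le> ?\<phi> u"
      using Greatest_attained[of \<U> ?\<phi>] by blast
    define r where "r = x \<bullet> (A *v x) + 2 * (a \<bullet> x) + ?\<phi> u"
    have rank_one: "\<A> (outer_square x, x) = b"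
      using A_valid lifted_in_G[OF x] by (auto simp: bordered_inject)
    have "join u x \<in> join_sets \<U> \<X>" using u(1) x by (auto simp: join_sets_def)
    then have "bordered (join u x) (block_mat (outer_square u) (outer x u) (outer_square x)) \<in> \<C>"
      using lifted_in_G G_C unfolding outer_square_join[symmetric] by blast
    then have "(x, outer x u, u, outer_square u, outer_square x) \<in> feasible \<C> \<A> b GU"
      using rank_one lifted_in_G[OF u(1)] G_GU
      by (auto simp: feasible_def outer_square_sym)
    moreover have "objective A a B C c (x, outer x u, u, outer_square u, outer_square x) = r"
      using A C by (simp add: objective_def frob_eq_inner inner_outer_square
          inner_transpose_outer r_def)
    ultimately have "ereal r \<le> ?m x" unfolding le_marginal_iff by force
    moreover have "?m x \<le> ereal r"
      unfolding marginal_def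
    proof (rule Sup_least, clarify)
      fix \<Psi> v W X
      assume feas: "(x, \<Psi>, v, W, X) \<in> feasible \<C> \<A> b GU"
      then have "2 * (v \<bullet> (B *v x)) + C \<bullet> W + 2 * (c \<bullet> v) \<le> ?\<phi> u"
        using u(3) by (intro GU_bound) (auto simp: feasible_def)
      with feasible_rank_one[OF feas rank_one] A
      show "ereal (objective A a B C c (x, \<Psi>, v, W, X)) \<le> ereal r"
        by (simp add: objective_def frob_eq_inner inner_outer_square inner_transpose_outer r_def)
    qed
    ultimately have "?m x = ereal r" by (rule antisym[rotated])
    then show ?thesis by (simp add: g f u(2) r_def)
  qed
  have "- \<infinity> < ?g x" if "x \<in> \<X>" for x
    using f_finite[OF that] tent[OF that] by (cases "f x") auto
  with concave usc less tent show ?thesis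
    by (auto simp: concave_tent_def closed_proper_concave_def intro!: ereal_concave_on_subset)
qed

theorem theorem8:
  fixes f h :: "real^'n \<Rightarrow> ereal"
    and A :: "real^'n^'n" and a :: "real^'n"
    and B :: "real^'n^'q" and C :: "real^'q^'q" and c :: "real^'q"
    and \<U> :: "(real^'q) set" and \<X> :: "(real^'n) set"
    and \<C> :: "(real^(('q + 'n) option)^(('q + 'n) option)) set"
    and \<A> :: "(real^'n^'n) \<times> (real^'n) \<Rightarrow> real^'m" and b :: "real^'m"
  assumes h: "closed_proper_concave h"
    and U: "\<U> \<noteq> {}" "compact \<U>" "convex \<U>"
    and sym: "A \<in> sym_mats" "C \<in> sym_mats"
    and f: "\<And>x. f x = h x + ereal (x \<bullet> (A *v x) + 2 * (a \<bullet> x)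
              + (GREATEST t. \<exists>u\<in>\<U>. t = 2 * (u \<bullet> (B *v x)) + u \<bullet> (C *v u) + 2 * (c \<bullet> u)))"
    and f_finite: "\<And>x. x \<in> \<X> \<Longrightarrow> \<bar>f x\<bar> \<noteq> \<infinity>"
    and C_closed: "closed \<C>" "convex \<C>"
    and C_bounds: "\<C> \<subseteq> psd_mats" "\<G> (join_sets \<U> \<X>) \<subseteq> \<C>"
    and A_linear: "linear_on_subspace (sym_mats \<times> UNIV) \<A>"
    and A_valid: "\<G> \<X> \<subseteq> {bordered x X | x X. bordered x X \<in> psd_mats \<and> \<A> (X, x) = b}"
    and A_kernel: "{X \<in> psd_mats. \<A> (X, 0) = 0} = {0}"
  shows "concave_tent \<X> f (relaxation h A a B C c \<C> \<A> b (\<G> \<U>)) \<and>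
    (\<X> \<noteq> {} \<longrightarrow> closed_proper_concave (relaxation h A a B C c \<C> \<A> b (\<G> \<U>))) \<and>
    (C = 0 \<longrightarrow>
      (\<forall>GU. GU \<subseteq> sym_mats \<and> compact GU \<and> convex GU \<and> \<G> \<U> \<subseteq> GU \<and>
            (\<forall>u W. bordered u W \<in> GU \<longrightarrow> u \<in> \<U>) \<longrightarrow>
        concave_tent \<X> f (relaxation h A a B C c \<C> \<A> b GU) \<and>
        (\<X> \<noteq> {} \<longrightarrow> closed_proper_concave (relaxation h A a B C c \<C> \<A> b GU))))"
proof -
  note tent = relaxation_closed_proper_concave_tent[OF h U(1,2) sym f f_finite C_bounds(2) A_valid]
  have "lifted_program \<C> \<A> (\<G> \<U>)"
    using C_closed C_bounds(1) A_linear A_kernel compact_lifted[OF U(2)]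
    by unfold_locales (auto simp: \<G>_def convex_closure)
  moreover have "2 * (u \<bullet> (B *v x)) + C \<bullet> W + 2 * (c \<bullet> u) \<le> t"
    if "bordered u W \<in> \<G> \<U>"
      "\<And>v. v \<in> \<U> \<Longrightarrow> 2 * (v \<bullet> (B *v x)) + v \<bullet> (C *v v) + 2 * (c \<bullet> v) \<le> t" for x u W t
    using G_linear_bound[of \<U> "B *v x + c" C t u W] that sym(2)
    by (simp add: inner_add_left inner_commute algebra_simps)
  ultimately have "concave_tent \<X> f (relaxation h A a B C c \<C> \<A> b (\<G> \<U>)) \<and>
    (\<X> \<noteq> {} \<longrightarrow> closed_proper_concave (relaxation h A a B C c \<C> \<A> b (\<G> \<U>)))"
    by (intro tent) auto
  moreover have "concave_tent \<X> f (relaxation h A a B C c \<C> \<A> b GU) \<and>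
    (\<X> \<noteq> {} \<longrightarrow> closed_proper_concave (relaxation h A a B C c \<C> \<A> b GU))"
    if C0: "C = 0" and GU: "compact GU" "convex GU" "\<G> \<U> \<subseteq> GU"
      "\<forall>u W. bordered u W \<in> GU \<longrightarrow> u \<in> \<U>" for GU
  proof (rule tent)
    show "lifted_program \<C> \<A> GU"
      using C_closed C_bounds(1) A_linear A_kernel GU by unfold_locales
    show "2 * (u \<bullet> (B *v x)) + C \<bullet> W + 2 * (c \<bullet> u) \<le> t"
      if "bordered u W \<in> GU"
        "\<And>v. v \<in> \<U> \<Longrightarrow> 2 * (v \<bullet> (B *v x)) + v \<bullet> (C *v v) + 2 * (c \<bullet> v) \<le> t" for x u W t
      using that(2)[of u] that(1) GU(4) C0 by auto
  qed (use GU in auto)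
  ultimately show ?thesis by blast
qed

end
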